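(* The $\mathbb F$-algebra $\Re$ has a presentation given by generators $A,B,\delta$ and relations $$[A,[A,[A,B]]]=2[A^2,B],$$ $$[B,[B,[B,A]]]=2[B^2,A],$$ $$[B,[A,[B,A]]]=2[A,B^2]-2[B,A^2]-2[A,B]\delta,$$ $$[A,[B,[A,B]]]=2[B,A^2]-2[A,B^2]-2[B,A]\delta,$$ $$\delta A=A\delta,\qquad \delta B=B\delta.$$ That is, the $\mathbb F$-algebra defined by these generators and relations is isomorphic to $\Re$ via the map sending each generator to the element of $\Re$ of the same name.
   Context: $\mathbb F$ is a field with $\operatorname{char}\mathbb F\neq 2$. All algebras are unital and associative. Write $[x,y]=xy-yx$. The Racah algebra $\Re$ is the $\mathbb F$-algebra defined by generators $A,B,C,D$ and the relations $[A,B]=[B,C]=[C,A]=2D$ together with the relations asserting that each of the elements $$[A,D]+AC-BA,\qquad [B,D]+BA-CB,\qquad [C,D]+CB-AC$$ is central in $\Re$. Set $\delta=A+B+C$. *)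

theory Defs
  imports "HOL-Library.Poly_Mapping" "HOL-Algebra.QuotRing" "HOL-Algebra.Module"
begin

section \<open>Free associative unital algebras\<close>

text \<open>
  Words are lists wrapped in a type of their own, so that concatenation can serve as the
  addition of the class \<^class>\<open>monoid_add\<close>.  The convolution product of
  \<^theory>\<open>HOL-Library.Poly_Mapping\<close> then makes \<open>'x word \<Rightarrow>\<^sub>0 'k\<close>
  the noncommutative polynomials over \<open>'k\<close> in the letters \<open>'x\<close>.
\<close>

datatype 'x word = Word (letters: "'x list")

instantiation word :: (type) monoid_add
begin

definition zero_word :: "'a word"
  where "0 = Word []"

definition plus_word :: "'a word \<Rightarrow> 'a word \<Rightarrow> 'a word"
  where "u + v = Word (letters u @ letters v)"

instance
  by standard (simp_all add: zero_word_def plus_word_def)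

end

type_synonym ('x, 'k) ncpoly = "'x word \<Rightarrow>\<^sub>0 'k"

definition var :: "'x \<Rightarrow> ('x, 'k::field) ncpoly"
  where "var x = Poly_Mapping.single (Word [x]) 1"

definition free_algebra :: "('k::field, ('x, 'k) ncpoly) module"
  where "free_algebra =
    \<lparr>carrier = UNIV, monoid.mult = (*), one = 1, zero = 0, add = (+),
     smult = (\<lambda>c. Poly_Mapping.map ((*) c))\<rparr>"

definition commutator :: "'a::ring \<Rightarrow> 'a \<Rightarrow> 'a"
  where "commutator x y = x * y - y * x"


section \<open>Algebras given by generators and relations\<close>

text \<open>
  A pair \<open>(p, q)\<close> stands for the relation \<open>p = q\<close>.  The ideals of
  \<^theory>\<open>HOL-Algebra.Ideal\<close> are two-sided; in a unital algebra
  they are closed under scalar multiplication.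
\<close>

definition relation_ideal :: "(('x, 'k::field) ncpoly \<times> ('x, 'k) ncpoly) set \<Rightarrow> ('x, 'k) ncpoly set"
  where "relation_ideal R = genideal free_algebra {p - q | p q. (p, q) \<in> R}"

text \<open>As for \<^const>\<open>rcoset_mult\<close>, the scalar multiple of a coset is a union over representatives.\<close>

definition quotient_algebra :: "('k, 'a, 'm) module_scheme \<Rightarrow> 'a set \<Rightarrow> ('k, 'a set) module"
  where "quotient_algebra M I =
    \<lparr>carrier = carrier (M Quot I), monoid.mult = monoid.mult (M Quot I), one = one (M Quot I),
     zero = zero (M Quot I), add = add (M Quot I),
     smult = (\<lambda>c X. \<Union>x\<in>X. I +>\<^bsub>M\<^esub> (c \<odot>\<^bsub>M\<^esub> x))\<rparr>"

definition presented_algebra ::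
    "(('x, 'k::field) ncpoly \<times> ('x, 'k) ncpoly) set \<Rightarrow> ('k, ('x, 'k) ncpoly set) module"
  where "presented_algebra R = quotient_algebra free_algebra (relation_ideal R)"

definition presented_gen ::
    "(('x, 'k::field) ncpoly \<times> ('x, 'k) ncpoly) set \<Rightarrow> 'x \<Rightarrow> ('x, 'k) ncpoly set"
  where "presented_gen R x = relation_ideal R +>\<^bsub>free_algebra\<^esub> var x"

definition algebra_iso ::
    "('k, 'a, 'm) module_scheme \<Rightarrow> ('k, 'b, 'n) module_scheme \<Rightarrow> ('a \<Rightarrow> 'b) set"
  where "algebra_iso M N =
    {h \<in> ring_iso M N. \<forall>c. \<forall>x \<in> carrier M. h (c \<odot>\<^bsub>M\<^esub> x) = c \<odot>\<^bsub>N\<^esub> h x}"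

lemma ring_free_algebra: "ring (free_algebra :: ('k::field, ('x, 'k) ncpoly) module)"
proof (rule ringI)
  show "abelian_group (free_algebra :: ('k, ('x, 'k) ncpoly) module)"
  proof (rule abelian_groupI)
    fix x :: "('x, 'k) ncpoly"
    show "\<exists>y\<in>carrier free_algebra. y \<oplus>\<^bsub>free_algebra\<^esub> x = \<zero>\<^bsub>free_algebra\<^esub>"
      by (intro bexI [of _ "- x"]) (simp_all add: free_algebra_def)
  qed (simp_all add: free_algebra_def algebra_simps)
  show "Group.monoid (free_algebra :: ('k, ('x, 'k) ncpoly) module)"
    by (rule monoidI) (simp_all add: free_algebra_def algebra_simps)
qed (simp_all add: free_algebra_def algebra_simps)

lemma ideal_relation_ideal: "ideal (relation_ideal R) free_algebra"
  unfolding relation_ideal_def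
  by (rule ring.genideal_ideal [OF ring_free_algebra]) (simp add: free_algebra_def)

lemma smult_free_algebra:
  "c \<odot>\<^bsub>free_algebra\<^esub> p = Poly_Mapping.single 0 c * p"
  for p :: "('x, 'k::field) ncpoly"
  by (simp add: free_algebra_def mult_map_scale_conv_mult)

lemma smult_presented_algebra:
  "c \<odot>\<^bsub>presented_algebra R\<^esub> (relation_ideal R +>\<^bsub>free_algebra\<^esub> p)
    = relation_ideal R +>\<^bsub>free_algebra\<^esub> (c \<odot>\<^bsub>free_algebra\<^esub> p)"
proof -
  interpret ideal "relation_ideal R" free_algebra
    by (rule ideal_relation_ideal)
  let ?I = "relation_ideal R" and ?F = "free_algebra :: ('b, ('a, 'b) ncpoly) module"
  have carr: "x \<in> carrier ?F" for x
    by (simp add: free_algebra_def)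
  have "?I +>\<^bsub>?F\<^esub> (c \<odot>\<^bsub>?F\<^esub> x) = ?I +>\<^bsub>?F\<^esub> (c \<odot>\<^bsub>?F\<^esub> p)"
    if x: "x \<in> ?I +>\<^bsub>?F\<^esub> p" for x
  proof -
    from x obtain i where i: "i \<in> ?I" "x = i + p"
      by (auto simp: a_r_coset_def' free_algebra_def)
    have "c \<odot>\<^bsub>?F\<^esub> x = c \<odot>\<^bsub>?F\<^esub> i \<oplus>\<^bsub>?F\<^esub> c \<odot>\<^bsub>?F\<^esub> p"
      unfolding i smult_free_algebra by (simp add: free_algebra_def algebra_simps)
    moreover have "c \<odot>\<^bsub>?F\<^esub> i \<in> ?I"
      using I_l_closed [OF i(1) carr, of "Poly_Mapping.single 0 c"]
      unfolding smult_free_algebra by (simp add: free_algebra_def)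
    ultimately have "c \<odot>\<^bsub>?F\<^esub> x \<in> ?I +>\<^bsub>?F\<^esub> (c \<odot>\<^bsub>?F\<^esub> p)"
      by (auto simp: a_r_coset_def')
    thus ?thesis
      by (rule a_repr_independence [OF _ carr a_subgroup, symmetric])
  qed
  moreover have "p \<in> ?I +>\<^bsub>?F\<^esub> p"
    by (rule a_rcos_self) (rule carr)
  ultimately have "(\<Union>x\<in>?I +>\<^bsub>?F\<^esub> p. ?I +>\<^bsub>?F\<^esub> (c \<odot>\<^bsub>?F\<^esub> x)) = ?I +>\<^bsub>?F\<^esub> (c \<odot>\<^bsub>?F\<^esub> p)"
    by blast
  thus ?thesis
    by (simp only: presented_algebra_def quotient_algebra_def module.select_convs)
qed


section \<open>The Racah algebra\<close>

datatype racah_gen = Gen_A | Gen_B | Gen_C | Gen_D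

definition racah_relations :: "((racah_gen, 'k::field) ncpoly \<times> (racah_gen, 'k) ncpoly) set"
  where "racah_relations =
    (let A = var Gen_A; B = var Gen_B; C = var Gen_C; D = var Gen_D in
      {(commutator A B, 2 * D),
       (commutator B C, 2 * D),
       (commutator C A, 2 * D)} \<union>
      {(z * x, x * z) | z x.
         z \<in> {commutator A D + A * C - B * A,
              commutator B D + B * A - C * B,
              commutator C D + C * B - A * C}})"

definition racah_algebra :: "('k::field, (racah_gen, 'k) ncpoly set) module"
  where "racah_algebra = presented_algebra racah_relations"

definition racah_A :: "(racah_gen, 'k::field) ncpoly set"
  where "racah_A = presented_gen racah_relations Gen_A"

definition racah_B :: "(racah_gen, 'k::field) ncpoly set"
  where "racah_B = presented_gen racah_relations Gen_B"

definition racah_C :: "(racah_gen, 'k::field) ncpoly set"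
  where "racah_C = presented_gen racah_relations Gen_C"

definition racah_delta :: "(racah_gen, 'k::field) ncpoly set"
  where "racah_delta =
    racah_A \<oplus>\<^bsub>racah_algebra\<^esub> racah_B \<oplus>\<^bsub>racah_algebra\<^esub> racah_C"


section \<open>The relations in terms of \<open>A\<close>, \<open>B\<close>, \<open>\<delta>\<close>\<close>

datatype delta_gen = Sym_A | Sym_B | Sym_delta

definition delta_relations :: "((delta_gen, 'k::field) ncpoly \<times> (delta_gen, 'k) ncpoly) set"
  where "delta_relations =
    (let A = var Sym_A; B = var Sym_B; \<delta> = var Sym_delta in
      {(commutator A (commutator A (commutator A B)),
          2 * commutator (A^2) B),
       (commutator B (commutator B (commutator B A)),
          2 * commutator (B^2) A),
       (commutator B (commutator A (commutator B A)),
          2 * commutator A (B^2) - 2 * commutator B (A^2) - 2 * commutator A B * \<delta>),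
       (commutator A (commutator B (commutator A B)),
          2 * commutator B (A^2) - 2 * commutator A (B^2) - 2 * commutator B A * \<delta>),
       (\<delta> * A, A * \<delta>),
       (\<delta> * B, B * \<delta>)})"

end

theory Submission
  imports Defs
begin

text \<open>
  Since \<open>2\<close> is invertible, \<open>C = \<delta> - A - B\<close> and \<open>D = [A,B]/2\<close> eliminate \<open>C\<close> and \<open>D\<close> from the
  Racah relations; the relations \<open>[A,B] = [B,C] = [C,A]\<close> then say that \<open>\<delta>\<close> commutes with \<open>A\<close>
  and \<open>B\<close>.  The element \<open>\<alpha> = [A,D] + AC - BA\<close> becomes \<open>[A,[A,B]]/2 + A\<delta> - A\<^sup>2 - AB - BA\<close>, and
  \<open>[A,\<alpha>] = 0\<close> is the first relation while \<open>[B,\<alpha>] = 0\<close> is the fourth; likewise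
  \<open>\<beta> = [B,D] + BA - CB\<close> yields the second and the fourth.  The third is the negative of the
  fourth by the Jacobi identity, and the last central element is \<open>[\<delta>,D] - \<alpha> - \<beta>\<close>.
  So the two substitutions respect the relations and are mutually inverse modulo the ideals.
\<close>

section \<open>Substitution in noncommutative polynomials\<close>

text \<open>A polynomial is the sum of its monomials over its finite support, so \<open>P\<close> is
  carried along the partial sums. The empty sum counts as a monomial with coefficient 0.\<close>

lemma ncpoly_monomial_induct [case_names single add]:
  assumes single: "\<And>w c. P (Poly_Mapping.single w c)"
    and add: "\<And>p q. P p \<Longrightarrow> P q \<Longrightarrow> P (p + q)"
  shows "P (p :: ('x, 'k::field) ncpoly)"
proof -
  have "P (\<Sum>w\<in>W. Poly_Mapping.single w (Poly_Mapping.lookup p w))" if "finite W" for W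
    using that
  proof (induction W)
    case empty
    show ?case
      using single [of 0 0] by simp
  next
    case (insert w W)
    then show ?case
      by (simp add: single add)
  qed
  moreover have "(\<Sum>w\<in>Poly_Mapping.keys p. Poly_Mapping.single w (Poly_Mapping.lookup p w)) = p"
    by (rule poly_mapping_eqI)
       (auto simp: lookup_sum lookup_single when_def in_keys_iff)
  ultimately show ?thesis
    by (metis finite_keys)
qed

lemma scalar_commute: "Poly_Mapping.single 0 c * p = p * Poly_Mapping.single 0 c"
  for p :: "('x, 'k::field) ncpoly"
  by (induction p rule: ncpoly_monomial_induct)
     (simp_all add: mult_single algebra_simps)

lemma single_eq_prod_list_var:
  "Poly_Mapping.single w c = Poly_Mapping.single 0 c * prod_list (map var (letters w))"
  for w :: "'x word" and c :: "'k::field"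
proof -
  have "Poly_Mapping.single (Word xs) 1 = (prod_list (map var xs) :: ('x, 'k) ncpoly)" for xs
  proof (induction xs)
    case Nil
    then show ?case
      by (simp flip: zero_word_def)
  next
    case (Cons x xs)
    have "Poly_Mapping.single (Word (x # xs)) 1
        = (var x * Poly_Mapping.single (Word xs) 1 :: ('x, 'k) ncpoly)"
      by (simp add: var_def mult_single plus_word_def)
    with Cons show ?case
      by simp
  qed
  note monomial = this
  show ?thesis
    by (simp add: mult_single flip: monomial)
qed

text \<open>Scalars and letters generate the free algebra under sums and products. This rule reduces
  congruences modulo an ideal to a check on letters.\<close>

lemma ncpoly_induct [case_names scalar var add mult]:
  assumes scalar: "\<And>c. P (Poly_Mapping.single 0 c)"
    and var: "\<And>x. P (var x)"
    and add: "\<And>p q. P p \<Longrightarrow> P q \<Longrightarrow> P (p + q)"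
    and mult: "\<And>p q. P p \<Longrightarrow> P q \<Longrightarrow> P (p * q)"
  shows "P (p :: ('x, 'k::field) ncpoly)"
proof (induction p rule: ncpoly_monomial_induct)
  case (single w c)
  have "P (prod_list (map var xs))" for xs
  proof (induction xs)
    case Nil
    show ?case
      using scalar [of 1] by simp
  next
    case (Cons x xs)
    then show ?case
      by (simp add: var mult)
  qed
  then show ?case
    by (subst single_eq_prod_list_var) (intro mult scalar)
qed (rule add)

text \<open>The algebra homomorphism given by the universal property of the free algebra.\<close>

definition ncpoly_subst :: "('x \<Rightarrow> ('y, 'k::field) ncpoly) \<Rightarrow> ('x, 'k) ncpoly \<Rightarrow> ('y, 'k) ncpoly"
  where "ncpoly_subst f p =
    (\<Sum>w\<in>Poly_Mapping.keys p.
      Poly_Mapping.single 0 (Poly_Mapping.lookup p w) * prod_list (map f (letters w)))"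

text \<open>Words outside the support contribute zero. A common index set for \<open>p\<close>,
  \<open>q\<close> and \<open>p + q\<close> then makes additivity a termwise statement.\<close>

lemma ncpoly_subst_superset:
  assumes "finite W" "Poly_Mapping.keys p \<subseteq> W"
  shows "ncpoly_subst f p =
    (\<Sum>w\<in>W. Poly_Mapping.single 0 (Poly_Mapping.lookup p w) * prod_list (map f (letters w)))"
  unfolding ncpoly_subst_def
  by (rule sum.mono_neutral_left) (use assms in \<open>auto simp: in_keys_iff\<close>)

lemma ncpoly_subst_add [simp]: "ncpoly_subst f (p + q) = ncpoly_subst f p + ncpoly_subst f q"
  using keys_add [of p q]
  by (simp add: ncpoly_subst_superset [where W = "Poly_Mapping.keys p \<union> Poly_Mapping.keys q"]
      lookup_add single_add distrib_right sum.distrib)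

lemma ncpoly_subst_single:
  "ncpoly_subst f (Poly_Mapping.single w c) = Poly_Mapping.single 0 c * prod_list (map f (letters w))"
  by (simp add: ncpoly_subst_def)

lemma ncpoly_subst_scalar [simp]:
  "ncpoly_subst f (Poly_Mapping.single 0 c) = Poly_Mapping.single 0 c"
  by (simp add: ncpoly_subst_single zero_word_def)

lemma ncpoly_subst_var [simp]: "ncpoly_subst f (var x) = f x"
  by (simp add: var_def ncpoly_subst_single)

lemma ncpoly_subst_zero [simp]: "ncpoly_subst f 0 = 0"
  using ncpoly_subst_scalar [of f 0] by simp

lemma ncpoly_subst_one [simp]: "ncpoly_subst f 1 = 1"
  using ncpoly_subst_scalar [of f 1] by simp

lemma ncpoly_subst_numeral [simp]: "ncpoly_subst f (numeral n) = numeral n"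
  using ncpoly_subst_scalar [of f "numeral n"] by simp

lemma ncpoly_subst_diff [simp]: "ncpoly_subst f (p - q) = ncpoly_subst f p - ncpoly_subst f q"
  by (metis add_diff_cancel_right' diff_add_cancel ncpoly_subst_add)

lemma ncpoly_subst_mult [simp]: "ncpoly_subst f (p * q) = ncpoly_subst f p * ncpoly_subst f q"
proof (induction p rule: ncpoly_monomial_induct)
  case (single u a)
  show ?case
  proof (induction q rule: ncpoly_monomial_induct)
    case (single v b)
    let ?f = "\<lambda>w. prod_list (map f (letters w))"
    have "Poly_Mapping.single 0 (a * b) * (?f u * ?f v)
        = Poly_Mapping.single 0 a * (Poly_Mapping.single 0 b * ?f u) * ?f v"
      by (simp add: mult_single flip: mult.assoc)
    then show ?case
      \<comment> \<open>The scalar \<open>b\<close> has to cross the image of \<open>u\<close> to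
        reach its place in front of the image of \<open>v\<close>.\<close>
      unfolding scalar_commute [of b]
      by (simp add: mult_single ncpoly_subst_single plus_word_def mult.assoc)
  qed (simp add: distrib_left)
qed (simp add: distrib_right)

lemma ncpoly_subst_power [simp]: "ncpoly_subst f (p ^ n) = ncpoly_subst f p ^ n"
  by (induction n) simp_all

lemma ncpoly_subst_commutator [simp]:
  "ncpoly_subst f (commutator p q) = commutator (ncpoly_subst f p) (ncpoly_subst f q)"
  by (simp add: commutator_def)


section \<open>Relation ideals\<close>

lemma carrier_free_algebra [simp]: "p \<in> carrier free_algebra"
  by (simp add: free_algebra_def)

lemma relation_ideal_zero [simp]: "0 \<in> relation_ideal R"
  using additive_subgroup.zero_closed [OF ideal.axioms(1) [OF ideal_relation_ideal, of R]]
  by (simp add: free_algebra_def)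

lemma relation_ideal_add: "p \<in> relation_ideal R \<Longrightarrow> q \<in> relation_ideal R \<Longrightarrow> p + q \<in> relation_ideal R"
  using additive_subgroup.a_closed [OF ideal.axioms(1) [OF ideal_relation_ideal, of R], of p q]
  by (simp add: free_algebra_def)

lemma relation_ideal_mult_left: "p \<in> relation_ideal R \<Longrightarrow> q * p \<in> relation_ideal R"
  using ideal.I_l_closed [OF ideal_relation_ideal, of p R q]
  by (simp add: free_algebra_def)

lemma relation_ideal_mult_right: "p \<in> relation_ideal R \<Longrightarrow> p * q \<in> relation_ideal R"
  using ideal.I_r_closed [OF ideal_relation_ideal, of p R q]
  by (simp add: free_algebra_def)

lemma relation_ideal_uminus: "p \<in> relation_ideal R \<Longrightarrow> - p \<in> relation_ideal R"
  using relation_ideal_mult_left [of p R "- 1"] by simp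

lemma relation_ideal_diff: "p \<in> relation_ideal R \<Longrightarrow> q \<in> relation_ideal R \<Longrightarrow> p - q \<in> relation_ideal R"
  using relation_ideal_add [OF _ relation_ideal_uminus, of p R q] by simp

lemma relation_ideal_commutator_left: "p \<in> relation_ideal R \<Longrightarrow> commutator p q \<in> relation_ideal R"
  by (simp add: commutator_def relation_ideal_diff relation_ideal_mult_left relation_ideal_mult_right)

lemma relation_ideal_commutator_right: "p \<in> relation_ideal R \<Longrightarrow> commutator q p \<in> relation_ideal R"
  by (simp add: commutator_def relation_ideal_diff relation_ideal_mult_left relation_ideal_mult_right)

lemmas relation_ideal_intros =
  relation_ideal_zero relation_ideal_add relation_ideal_diff relation_ideal_uminus
  relation_ideal_mult_left relation_ideal_mult_right
  relation_ideal_commutator_left relation_ideal_commutator_right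

lemma relation_ideal_rel: "(p, q) \<in> R \<Longrightarrow> p - q \<in> relation_ideal R"
  using ring.genideal_self [OF ring_free_algebra, of "{p - q | p q. (p, q) \<in> R}"]
  by (force simp: relation_ideal_def free_algebra_def)

text \<open>The closure conditions make the polynomials satisfying \<open>P\<close> a two-sided
  ideal, negation being multiplication by -1. It contains the generators, hence the least ideal
  containing them.\<close>

lemma relation_ideal_induct [consumes 1, case_names rel zero add mult_left mult_right]:
  assumes p: "p \<in> relation_ideal R"
    and rel: "\<And>p q. (p, q) \<in> R \<Longrightarrow> P (p - q)"
    and zero: "P 0"
    and add: "\<And>p q. P p \<Longrightarrow> P q \<Longrightarrow> P (p + q)"
    and mult_left: "\<And>p q. P p \<Longrightarrow> P (q * p)"
    and mult_right: "\<And>p q. P p \<Longrightarrow> P (p * q)"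
  shows "P (p :: ('x, 'k::field) ncpoly)"
proof -
  let ?F = "free_algebra :: ('k, ('x, 'k) ncpoly) module"
  interpret ring ?F
    by (rule ring_free_algebra)
  have uminus: "\<ominus>\<^bsub>?F\<^esub> q = - q" for q
    by (rule minus_equality) (simp_all add: free_algebra_def)
  have "ideal {q. P q} ?F"
  proof (rule idealI [OF ring_free_algebra])
    show "subgroup {q. P q} (add_monoid ?F)"
    proof (rule add.subgroupI)
      fix q assume "q \<in> {q. P q}"
      then show "\<ominus>\<^bsub>?F\<^esub> q \<in> {q. P q}"
        using mult_left [of q "- 1"] by (simp add: uminus)
    qed (use zero add in \<open>auto simp: free_algebra_def\<close>)
  qed (simp_all add: free_algebra_def mult_left mult_right)
  then have "relation_ideal R \<subseteq> {q. P q}"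
    unfolding relation_ideal_def by (rule genideal_minimal) (use rel in auto)
  with p show ?thesis
    by auto
qed

text \<open>The preimage of an ideal under a homomorphism is an ideal, so it is enough to look at
  the defining relations. This lets a substitution descend to the quotients.\<close>

lemma ncpoly_subst_relation_ideal:
  assumes "\<And>p q. (p, q) \<in> R \<Longrightarrow> ncpoly_subst f p - ncpoly_subst f q \<in> relation_ideal S"
    and "p \<in> relation_ideal R"
  shows "ncpoly_subst f p \<in> relation_ideal S"
  using assms(2) by (induction rule: relation_ideal_induct) (auto simp: assms(1) relation_ideal_intros)

text \<open>The polynomials fixed by the round trip modulo the ideal form a subalgebra, and by
  assumption it contains every letter.\<close>

lemma ncpoly_subst_subst_cong:
  assumes "\<And>x. ncpoly_subst g (f x) - var x \<in> relation_ideal R"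
  shows "ncpoly_subst g (ncpoly_subst f p) - p \<in> relation_ideal R"
proof (induction p rule: ncpoly_induct)
  case (add p q)
  from relation_ideal_add [OF this] show ?case
    by (simp add: algebra_simps)
next
  case (mult p q)
  let ?h = "\<lambda>p. ncpoly_subst g (ncpoly_subst f p)"
  have "?h (p * q) - p * q = ?h p * (?h q - q) + (?h p - p) * q"
    by (simp add: algebra_simps)
  also have "\<dots> \<in> relation_ideal R"
    using mult by (intro relation_ideal_add relation_ideal_mult_left relation_ideal_mult_right)
  finally show ?case .
qed (use assms in simp_all)

text \<open>The map \<open>commutator z\<close> is a derivation that kills scalars, so centrality
  modulo the ideal can be tested on letters.\<close>

lemma commutator_relation_ideal:
  assumes "\<And>x. commutator z (var x) \<in> relation_ideal R"
  shows "commutator z p \<in> relation_ideal R"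
proof (induction p rule: ncpoly_induct)
  case (scalar c)
  then show ?case
    by (simp add: commutator_def flip: scalar_commute)
next
  case (add p q)
  from relation_ideal_add [OF this] show ?case
    by (simp add: commutator_def algebra_simps)
next
  case (mult p q)
  have "commutator z (p * q) = commutator z p * q + p * commutator z q"
    by (simp add: commutator_def algebra_simps)
  with mult show ?case
    by (simp add: relation_ideal_add relation_ideal_mult_left relation_ideal_mult_right)
qed (rule assms)


section \<open>Isomorphisms of presented algebras\<close>

abbreviation relation_coset ::
    "(('x, 'k::field) ncpoly \<times> ('x, 'k) ncpoly) set \<Rightarrow> ('x, 'k) ncpoly \<Rightarrow> ('x, 'k) ncpoly set"
  where "relation_coset R p \<equiv> relation_ideal R +>\<^bsub>free_algebra\<^esub> p"

lemma relation_coset_eq_iff: "relation_coset R p = relation_coset R q \<longleftrightarrow> p - q \<in> relation_ideal R"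
proof -
  have *: "relation_coset R r = (\<lambda>i. i + r) ` relation_ideal R" for r
    by (auto simp: a_r_coset_def' free_algebra_def)
  show ?thesis
  proof
    assume "relation_coset R p = relation_coset R q"
    then have "p \<in> relation_coset R q"
      unfolding * by (metis add_0 image_eqI relation_ideal_zero)
    then show "p - q \<in> relation_ideal R"
      unfolding * by auto
  next
    assume pq: "p - q \<in> relation_ideal R"
    have "relation_coset R r \<subseteq> relation_coset R s" if "r - s \<in> relation_ideal R" for r s
    proof -
      have "i + r \<in> (\<lambda>i. i + s) ` relation_ideal R" if "i \<in> relation_ideal R" for i
        using relation_ideal_add [OF that \<open>r - s \<in> relation_ideal R\<close>]
        by (intro image_eqI [of _ _ "i + (r - s)"]) simp_all
      then show ?thesis
        unfolding * by auto
    qed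
    from this [OF pq] this [of q p] relation_ideal_uminus [OF pq]
    show "relation_coset R p = relation_coset R q"
      by auto
  qed
qed

lemma carrier_presented_algebra: "carrier (presented_algebra R) = range (relation_coset R)"
  by (auto simp: presented_algebra_def quotient_algebra_def FactRing_def A_RCOSETS_def'
      free_algebra_def)

lemma presented_algebra_one: "\<one>\<^bsub>presented_algebra R\<^esub> = relation_coset R 1"
  by (simp add: presented_algebra_def quotient_algebra_def FactRing_def)
     (simp add: free_algebra_def)

lemma presented_algebra_add:
  "relation_coset R p \<oplus>\<^bsub>presented_algebra R\<^esub> relation_coset R q = relation_coset R (p + q)"
proof -
  interpret ideal "relation_ideal R" free_algebra
    by (rule ideal_relation_ideal)
  have "relation_coset R p \<oplus>\<^bsub>presented_algebra R\<^esub> relation_coset R q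
      = relation_coset R (p \<oplus>\<^bsub>free_algebra\<^esub> q)"
    unfolding presented_algebra_def quotient_algebra_def FactRing_def
    by (simp add: a_rcos_sum)
  then show ?thesis
    by (simp add: free_algebra_def)
qed

lemma presented_algebra_mult:
  "relation_coset R p \<otimes>\<^bsub>presented_algebra R\<^esub> relation_coset R q = relation_coset R (p * q)"
proof -
  interpret ideal "relation_ideal R" free_algebra
    by (rule ideal_relation_ideal)
  have "relation_coset R p \<otimes>\<^bsub>presented_algebra R\<^esub> relation_coset R q
      = relation_coset R (p \<otimes>\<^bsub>free_algebra\<^esub> q)"
    unfolding presented_algebra_def quotient_algebra_def FactRing_def
    by (simp add: rcoset_mult_add)
  then show ?thesis
    by (simp add: free_algebra_def)
qed

text \<open>By \<open>f\<close> and \<open>g\<close> both substitutions descend to the quotients; by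
  \<open>gf\<close> and \<open>fg\<close> they are inverse to each other on letters, hence
  everywhere.\<close>

lemma presented_algebra_iso:
  fixes f :: "'x \<Rightarrow> ('y, 'k::field) ncpoly" and g :: "'y \<Rightarrow> ('x, 'k) ncpoly"
  assumes f: "\<And>p q. (p, q) \<in> R \<Longrightarrow> ncpoly_subst f p - ncpoly_subst f q \<in> relation_ideal S"
    and g: "\<And>p q. (p, q) \<in> S \<Longrightarrow> ncpoly_subst g p - ncpoly_subst g q \<in> relation_ideal R"
    and gf: "\<And>x. ncpoly_subst g (f x) - var x \<in> relation_ideal R"
    and fg: "\<And>y. ncpoly_subst f (g y) - var y \<in> relation_ideal S"
  obtains \<phi> where "\<phi> \<in> algebra_iso (presented_algebra R) (presented_algebra S)"
    and "\<And>x. \<phi> (presented_gen R x) = relation_coset S (f x)"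
proof -
  \<comment> \<open>All representatives of a coset yield the same image coset, so the union equals
    that coset and no representative has to be chosen.\<close>
  define \<phi> where "\<phi> = (\<lambda>X. \<Union>p\<in>X. relation_coset S (ncpoly_subst f p))"
  have \<phi>: "\<phi> (relation_coset R p) = relation_coset S (ncpoly_subst f p)" for p
  proof -
    have "relation_coset S (ncpoly_subst f q) = relation_coset S (ncpoly_subst f p)"
      if "q \<in> relation_coset R p" for q
    proof -
      from that have "q - p \<in> relation_ideal R"
        by (auto simp: a_r_coset_def' free_algebra_def)
      from ncpoly_subst_relation_ideal [OF f this] show ?thesis
        by (simp add: relation_coset_eq_iff)
    qed
    moreover have "p \<in> relation_coset R p"
      by (force simp: a_r_coset_def' free_algebra_def)
    ultimately show ?thesis
      unfolding \<phi>_def by blast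
  qed
  have "\<phi> \<in> ring_hom (presented_algebra R) (presented_algebra S)"
    by (rule ring_hom_memI)
       (auto simp: carrier_presented_algebra presented_algebra_one presented_algebra_add
         presented_algebra_mult \<phi>)
  moreover have "bij_betw \<phi> (carrier (presented_algebra R)) (carrier (presented_algebra S))"
    unfolding bij_betw_def carrier_presented_algebra
  proof
    show "inj_on \<phi> (range (relation_coset R))"
    proof (rule inj_onI, clarify)
      fix p q
      assume "\<phi> (relation_coset R p) = \<phi> (relation_coset R q)"
      then have "ncpoly_subst f (p - q) \<in> relation_ideal S"
        by (simp add: \<phi> relation_coset_eq_iff)
      \<comment> \<open>Substituting back by \<open>g\<close> returns \<open>p - q\<close> up to an
        element of the ideal of \<open>R\<close>.\<close>
      from ncpoly_subst_relation_ideal [OF g this]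
      have "ncpoly_subst g (ncpoly_subst f (p - q)) \<in> relation_ideal R" .
      from relation_ideal_diff [OF this ncpoly_subst_subst_cong [OF gf, of "p - q"]]
      show "relation_coset R p = relation_coset R q"
        by (simp add: relation_coset_eq_iff)
    qed
  next
    have "relation_coset S p \<in> \<phi> ` range (relation_coset R)" for p
    proof (rule image_eqI)
      show "relation_coset S p = \<phi> (relation_coset R (ncpoly_subst g p))"
        unfolding \<phi> using relation_ideal_uminus [OF ncpoly_subst_subst_cong [OF fg, of p]]
        by (simp add: relation_coset_eq_iff)
    qed simp
    then show "\<phi> ` range (relation_coset R) = range (relation_coset S)"
      by (auto simp: \<phi>)
  qed
  moreover have "\<phi> (c \<odot>\<^bsub>presented_algebra R\<^esub> X) = c \<odot>\<^bsub>presented_algebra S\<^esub> \<phi> X"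
    if "X \<in> carrier (presented_algebra R)" for c X
    using that
    by (auto simp: carrier_presented_algebra smult_presented_algebra \<phi> smult_free_algebra)
  ultimately have "\<phi> \<in> algebra_iso (presented_algebra R) (presented_algebra S)"
    by (simp add: algebra_iso_def ring_iso_def)
  then show thesis
    by (rule that) (simp add: presented_gen_def \<phi>)
qed


section \<open>The two presentations of the Racah algebra\<close>

text \<open>The \<open>r\<close>'s measure the failure of the first three Racah relations. Each
  right-hand side is built from them and from commutators with \<alpha> or \<beta>, so it visibly
  lies in the Racah ideal. The bracket in the third and fourth identities is [\<delta>,[A,B]],
  expanded by the Jacobi identity through [\<delta>,A] = \<open>r\<^sub>3 - r\<^sub>1\<close> and
  [\<delta>,B] = \<open>r\<^sub>1 - r\<^sub>2\<close>.\<close>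

lemma racah_commutator_identities:
  fixes A B C D \<delta> :: "'a::ring_1"
  assumes \<delta>: "\<delta> = A + B + C"
    and r: "r\<^sub>1 = commutator A B - 2 * D" "r\<^sub>2 = commutator B C - 2 * D" "r\<^sub>3 = commutator C A - 2 * D"
    and \<alpha>: "\<alpha> = commutator A D + A * C - B * A"
    and \<beta>: "\<beta> = commutator B D + B * A - C * B"
  shows "commutator A (commutator A (commutator A B)) - 2 * commutator (A\<^sup>2) B
      = commutator A (commutator A r\<^sub>1) + 2 * commutator A \<alpha> + 2 * A * (r\<^sub>3 - r\<^sub>1)"
    and "commutator B (commutator B (commutator B A)) - 2 * commutator (B\<^sup>2) A
      = 2 * (r\<^sub>1 - r\<^sub>2) * B - commutator B (commutator B r\<^sub>1) - 2 * commutator B \<beta>"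
    and "commutator B (commutator A (commutator B A))
        - (2 * commutator A (B\<^sup>2) - 2 * commutator B (A\<^sup>2) - 2 * commutator A B * \<delta>)
      = 2 * (r\<^sub>3 - r\<^sub>1) * B - commutator A (commutator B r\<^sub>1) - 2 * commutator A \<beta>
        - 2 * (commutator (r\<^sub>3 - r\<^sub>1) B + commutator A (r\<^sub>1 - r\<^sub>2))"
    and "commutator A (commutator B (commutator A B))
        - (2 * commutator B (A\<^sup>2) - 2 * commutator A (B\<^sup>2) - 2 * commutator B A * \<delta>)
      = commutator A (commutator B r\<^sub>1) + 2 * commutator A \<beta> + 2 * (r\<^sub>1 - r\<^sub>3) * B
        + 2 * (commutator (r\<^sub>3 - r\<^sub>1) B + commutator A (r\<^sub>1 - r\<^sub>2))"
    and "\<delta> * A - A * \<delta> = r\<^sub>3 - r\<^sub>1"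
    and "\<delta> * B - B * \<delta> = r\<^sub>1 - r\<^sub>2"
  by (simp_all add: assms commutator_def power2_eq_square mult_2 algebra_simps)

text \<open>Here \<open>\<alpha>\<close> and \<open>\<beta>\<close> are twice the central elements of the Racah algebra.\<close>

lemma delta_commutator_identities:
  fixes A B C \<delta> :: "'a::ring_1"
  assumes C: "C = \<delta> - A - B"
    and \<alpha>: "\<alpha> = commutator A (commutator A B) + 2 * (A * C - B * A)"
    and \<beta>: "\<beta> = commutator B (commutator A B) + 2 * (B * A - C * B)"
    and r\<^sub>1: "r\<^sub>1 = commutator A (commutator A (commutator A B)) - 2 * commutator (A\<^sup>2) B"
    and r\<^sub>2: "r\<^sub>2 = commutator B (commutator B (commutator B A)) - 2 * commutator (B\<^sup>2) A"
    and r\<^sub>4: "r\<^sub>4 = commutator A (commutator B (commutator A B))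
        - (2 * commutator B (A\<^sup>2) - 2 * commutator A (B\<^sup>2) - 2 * commutator B A * \<delta>)"
  shows "commutator \<alpha> A = 2 * A * commutator \<delta> A - r\<^sub>1"
    and "commutator \<alpha> B = 2 * A * commutator \<delta> B - r\<^sub>4"
    and "commutator \<beta> A = 2 * commutator \<delta> (commutator A B) - 2 * commutator \<delta> A * B - r\<^sub>4"
    and "commutator \<beta> B = r\<^sub>2 - 2 * commutator \<delta> B * B"
  by (simp_all add: assms commutator_def power2_eq_square mult_2 algebra_simps)

section \<open>Halving, and scalars inside commutators\<close>

lemma scalar_half:
  assumes "CHAR('k::field) \<noteq> 2"
  shows "Poly_Mapping.single 0 (1 / 2) * (2 * p) = (p :: ('x, 'k) ncpoly)"
proof -
  \<comment> \<open>A characteristic dividing 2 would be 1 or 2. Excluding both makes 2 invertible,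
    so that \<open>1 / 2\<close> is a true inverse and not the default value of division by
    zero.\<close>
  have "CHAR('k) \<noteq> 1"
    by simp
  have "\<not> CHAR('k) dvd 2"
  proof
    assume dvd: "CHAR('k) dvd 2"
    then have "CHAR('k) \<le> 2"
      by (rule dvd_imp_le) simp
    with assms \<open>CHAR('k) \<noteq> 1\<close> have "CHAR('k) = 0"
      by linarith
    with dvd show False
      by simp
  qed
  then have "(2 :: 'k) \<noteq> 0"
    using of_nat_eq_0_iff_char_dvd [of 2, where 'a = 'k] by simp
  then have "Poly_Mapping.single 0 (1 / 2) * 2 = (1 :: ('x, 'k) ncpoly)"
    by (simp add: mult_single flip: single_numeral)
  then show ?thesis
    by (simp flip: mult.assoc)
qed

lemma commutator_scalar_left:
  "commutator (Poly_Mapping.single 0 c * p) q = Poly_Mapping.single 0 c * commutator p q"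
  for p :: "('x, 'k::field) ncpoly"
  by (simp add: commutator_def right_diff_distrib scalar_commute [of c q] flip: mult.assoc)

lemma commutator_scalar_right:
  "commutator p (Poly_Mapping.single 0 c * q) = Poly_Mapping.single 0 c * commutator p q"
  for p :: "('x, 'k::field) ncpoly"
proof -
  have "commutator p r = - commutator r p" for r
    by (simp add: commutator_def)
  then show ?thesis
    by (simp add: commutator_scalar_left)
qed

section \<open>The two mutually inverse substitutions\<close>

fun delta_to_racah :: "delta_gen \<Rightarrow> (racah_gen, 'k::field) ncpoly" where
  "delta_to_racah Sym_A = var Gen_A"
| "delta_to_racah Sym_B = var Gen_B"
| "delta_to_racah Sym_delta = var Gen_A + var Gen_B + var Gen_C"

fun racah_to_delta :: "racah_gen \<Rightarrow> (delta_gen, 'k::field) ncpoly" where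
  "racah_to_delta Gen_A = var Sym_A"
| "racah_to_delta Gen_B = var Sym_B"
| "racah_to_delta Gen_C = var Sym_delta - var Sym_A - var Sym_B"
| "racah_to_delta Gen_D = Poly_Mapping.single 0 (1 / 2) * commutator (var Sym_A) (var Sym_B)"

lemma delta_to_racah_relations:
  assumes "(p, q) \<in> (delta_relations :: ((delta_gen, 'k::field) ncpoly \<times> _) set)"
  shows "ncpoly_subst delta_to_racah p - ncpoly_subst delta_to_racah q \<in> relation_ideal racah_relations"
proof -
  define A B C D :: "(racah_gen, 'k) ncpoly"
    where "A = var Gen_A" and "B = var Gen_B" and "C = var Gen_C" and "D = var Gen_D"
  note vars = A_def [symmetric] B_def [symmetric] C_def [symmetric] D_def [symmetric]
  define \<delta> where "\<delta> = A + B + C"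
  define r\<^sub>1 r\<^sub>2 r\<^sub>3 where "r\<^sub>1 = commutator A B - 2 * D" and "r\<^sub>2 = commutator B C - 2 * D"
    and "r\<^sub>3 = commutator C A - 2 * D"
  define \<alpha> \<beta> where "\<alpha> = commutator A D + A * C - B * A" and "\<beta> = commutator B D + B * A - C * B"
  note identities =
    racah_commutator_identities [OF \<delta>_def r\<^sub>1_def r\<^sub>2_def r\<^sub>3_def \<alpha>_def \<beta>_def]
  let ?I = "relation_ideal (racah_relations :: ((racah_gen, 'k) ncpoly \<times> _) set)"
  have r: "r\<^sub>1 \<in> ?I" "r\<^sub>2 \<in> ?I" "r\<^sub>3 \<in> ?I"
    unfolding r\<^sub>1_def r\<^sub>2_def r\<^sub>3_def
    by (rule relation_ideal_rel, simp add: racah_relations_def Let_def vars)+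
  \<comment> \<open>Centrality is imposed against every polynomial \<open>x\<close>. The relation
    gives the commutator in the opposite order, hence the change of sign.\<close>
  have central: "commutator x \<alpha> \<in> ?I" "commutator x \<beta> \<in> ?I" for x
  proof -
    have "(\<alpha> * x, x * \<alpha>) \<in> racah_relations" "(\<beta> * x, x * \<beta>) \<in> racah_relations"
      unfolding racah_relations_def Let_def vars \<alpha>_def \<beta>_def by blast+
    from this [THEN relation_ideal_rel, THEN relation_ideal_uminus]
    show "commutator x \<alpha> \<in> ?I" "commutator x \<beta> \<in> ?I"
      by (simp_all add: commutator_def)
  qed
  from assms show ?thesis
    unfolding delta_relations_def Let_def
    by (elim insertE emptyE Pair_inject)
       (simp_all add: vars identities r central relation_ideal_intros flip: \<delta>_def)
qed

text \<open>The computation is done with the doubled elements \<alpha>, \<beta>, \<gamma>, which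
  have integer coefficients; the factor \<open>h\<close>, one half, is restored only at the
  end.\<close>

lemma racah_to_delta_relations:
  assumes char: "CHAR('k::field) \<noteq> 2"
    and pq: "(p, q) \<in> (racah_relations :: ((racah_gen, 'k::field) ncpoly \<times> _) set)"
  shows "ncpoly_subst racah_to_delta p - ncpoly_subst racah_to_delta q \<in> relation_ideal delta_relations"
proof -
  define A B \<delta> :: "(delta_gen, 'k) ncpoly"
    where "A = var Sym_A" and "B = var Sym_B" and "\<delta> = var Sym_delta"
  note vars = A_def [symmetric] B_def [symmetric] \<delta>_def [symmetric]
  define C where "C = \<delta> - A - B"
  define h :: "(delta_gen, 'k) ncpoly" where "h = Poly_Mapping.single 0 (1 / 2)"
  define X where "X = commutator A B"
  define \<alpha> \<beta> \<gamma> where "\<alpha> = commutator A X + 2 * (A * C - B * A)"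
    and "\<beta> = commutator B X + 2 * (B * A - C * B)"
    and "\<gamma> = commutator C X + 2 * (C * B - A * C)"
  define r\<^sub>1 r\<^sub>2 r\<^sub>4
    where "r\<^sub>1 = commutator A (commutator A (commutator A B)) - 2 * commutator (A\<^sup>2) B"
      and "r\<^sub>2 = commutator B (commutator B (commutator B A)) - 2 * commutator (B\<^sup>2) A"
      and "r\<^sub>4 = commutator A (commutator B (commutator A B))
        - (2 * commutator B (A\<^sup>2) - 2 * commutator A (B\<^sup>2) - 2 * commutator B A * \<delta>)"
  note identities = delta_commutator_identities
    [OF C_def \<alpha>_def [unfolded X_def] \<beta>_def [unfolded X_def] r\<^sub>1_def r\<^sub>2_def r\<^sub>4_def]
  let ?I = "relation_ideal (delta_relations :: ((delta_gen, 'k) ncpoly \<times> _) set)"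
  have r: "r\<^sub>1 \<in> ?I" "r\<^sub>2 \<in> ?I" "r\<^sub>4 \<in> ?I"
    unfolding r\<^sub>1_def r\<^sub>2_def r\<^sub>4_def
    by (rule relation_ideal_rel, simp add: delta_relations_def Let_def vars)+
  have \<delta>_var: "commutator \<delta> (var x) \<in> ?I" for x
  proof (cases x)
    case Sym_A
    then show ?thesis
      unfolding commutator_def
      by (intro relation_ideal_rel) (simp add: delta_relations_def Let_def vars)
  next
    case Sym_B
    then show ?thesis
      unfolding commutator_def
      by (intro relation_ideal_rel) (simp add: delta_relations_def Let_def vars)
  next
    case Sym_delta
    then show ?thesis
      by (simp add: commutator_def vars)
  qed
  have \<delta>: "commutator \<delta> p \<in> ?I" for p
    by (rule commutator_relation_ideal) (rule \<delta>_var)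
  \<comment> \<open>The remaining letter \<delta> is covered because \<delta> is already central
    modulo the ideal.\<close>
  have central: "commutator z p \<in> ?I" if "commutator z A \<in> ?I" "commutator z B \<in> ?I" for z p
  proof (rule commutator_relation_ideal)
    fix x
    have "commutator z \<delta> = - commutator \<delta> z"
      by (simp add: commutator_def)
    with that \<delta> show "commutator z (var x) \<in> ?I"
      by (cases x) (simp_all add: vars relation_ideal_uminus)
  qed
  have \<alpha>: "commutator \<alpha> p \<in> ?I" and \<beta>: "commutator \<beta> p \<in> ?I" for p
    by (rule central; simp add: identities r \<delta> relation_ideal_intros)+
  \<comment> \<open>In the sum of \<alpha>, \<beta> and \<gamma> the quadratic terms cancel
    cyclically, and A + B + C = \<delta> leaves only [\<delta>,X].\<close>
  have \<gamma>_eq: "\<gamma> = commutator \<delta> X - \<alpha> - \<beta>"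
    by (simp add: \<alpha>_def \<beta>_def \<gamma>_def C_def commutator_def algebra_simps)
  have "commutator \<gamma> p
      = commutator (commutator \<delta> X) p - commutator \<alpha> p - commutator \<beta> p" for p
    by (simp add: \<gamma>_eq commutator_def algebra_simps)
  with \<alpha> \<beta> \<delta> have \<gamma>: "commutator \<gamma> p \<in> ?I" for p
    by (simp add: relation_ideal_intros)
  have half: "h * (2 * p) = p" for p
    unfolding h_def by (rule scalar_half [OF char])
  have D: "2 * (h * p) = p" for p
    using half [of p] scalar_commute [of "1 / 2" "2 :: (delta_gen, 'k) ncpoly"]
    by (simp add: h_def flip: mult.assoc)
  \<comment> \<open>The left-hand sides are the images of the three central elements, since
    \<open>Gen_D\<close> is sent to \<open>h * X\<close>.\<close>
  have h\<alpha>: "commutator A (h * X) + A * C - B * A = h * \<alpha>"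
    and h\<beta>: "commutator B (h * X) + B * A - C * B = h * \<beta>"
    and h\<gamma>: "commutator C (h * X) + C * B - A * C = h * \<gamma>"
    unfolding \<alpha>_def \<beta>_def \<gamma>_def distrib_left half
    by (simp_all only: h_def commutator_scalar_right add_diff_eq)
  have h: "h * z * p - p * (h * z) \<in> ?I" if "commutator z p \<in> ?I" for z p
    using relation_ideal_mult_left [OF that, of h]
    unfolding h_def commutator_scalar_left [symmetric] by (simp only: commutator_def)
  \<comment> \<open>As 2D is sent to \<open>X\<close>, these are the images of the second and third
    Racah relations; the first one becomes trivial.\<close>
  have BC: "commutator B C - X = - commutator \<delta> B" and CA: "commutator C A - X = commutator \<delta> A"
    by (simp_all add: C_def X_def commutator_def algebra_simps)
  from pq show ?thesis
    unfolding racah_relations_def Let_def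
    by (auto simp: vars D BC CA \<delta> relation_ideal_uminus h\<alpha> h\<beta> h\<gamma> h \<alpha> \<beta> \<gamma>
        simp flip: C_def h_def X_def)
qed

theorem proposition3p6:
  assumes "CHAR('k::field) \<noteq> 2"
  shows "\<exists>\<phi> \<in> algebra_iso (presented_algebra delta_relations)
                          (racah_algebra :: ('k, (racah_gen, 'k) ncpoly set) module).
           \<phi> (presented_gen delta_relations Sym_A) = racah_A \<and>
           \<phi> (presented_gen delta_relations Sym_B) = racah_B \<and>
           \<phi> (presented_gen delta_relations Sym_delta) = racah_delta"
proof -
  \<comment> \<open>This round trip fixes each letter exactly: A + B + (\<delta> - A - B) =
    \<delta>.\<close>
  have gf: "ncpoly_subst racah_to_delta (delta_to_racah x) - var x
      \<in> relation_ideal (delta_relations :: ((delta_gen, 'k) ncpoly \<times> _) set)" for x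
    by (cases x) simp_all
  have fg: "ncpoly_subst delta_to_racah (racah_to_delta y) - var y
      \<in> relation_ideal (racah_relations :: ((racah_gen, 'k) ncpoly \<times> _) set)" for y
  proof (cases y)
    case Gen_D
    \<comment> \<open>Only D is moved by this round trip: it goes to [A,B]/2, which differs from D
      by half of \<open>?r\<close>, the defect of the first Racah relation.\<close>
    let ?r = "commutator (var Gen_A) (var Gen_B) - 2 * var Gen_D :: (racah_gen, 'k) ncpoly"
    have "ncpoly_subst delta_to_racah (racah_to_delta y) - var y = Poly_Mapping.single 0 (1 / 2) * ?r"
      using scalar_half [OF assms, of "var Gen_D :: (racah_gen, 'k) ncpoly"]
      by (simp add: Gen_D right_diff_distrib)
    moreover have "?r \<in> relation_ideal racah_relations"
      by (rule relation_ideal_rel) (simp add: racah_relations_def Let_def)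
    ultimately show ?thesis
      by (simp add: relation_ideal_mult_left)
  qed simp_all
  obtain \<phi> :: "(delta_gen, 'k) ncpoly set \<Rightarrow> _"
    where "\<phi> \<in> algebra_iso (presented_algebra delta_relations) (presented_algebra racah_relations)"
      and "\<And>x. \<phi> (presented_gen delta_relations x) = relation_coset racah_relations (delta_to_racah x)"
    using presented_algebra_iso
      [OF delta_to_racah_relations racah_to_delta_relations [OF assms] gf fg]
    by blast
  then show ?thesis
    by (intro bexI [of _ \<phi>])
       (simp_all add: racah_A_def racah_B_def racah_C_def racah_delta_def racah_algebra_def
         presented_gen_def presented_algebra_add)
qed

end
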